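(* Let $Q$ be a connected quandle with base point $q\in Q$. Let $$\tilde Q=\{(a,g)\in Q\times\mathrm{Adj}(Q)'\mid a=q^g\},\qquad\tilde q=(q,1),$$ which is a connected quandle with the operations $$(a,g)*(b,h)=\bigl(a*b,\;g\cdot\mathrm{adj}(a)^{-1}\cdot\mathrm{adj}(b)\bigr),\qquad(a,g)\,\bar{*}\,(b,h)=\bigl(a\,\bar{*}\,b,\;g\cdot\mathrm{adj}(a)\cdot\mathrm{adj}(b)^{-1}\bigr).$$ Then the canonical projection $p\colon(\tilde Q,\tilde q)\to(Q,q)$, $p(a,g)=a$, is the universal quandle covering of $(Q,q)$.
   Context: A quandle is a set $Q$ with two binary operations $*,\bar{*}$ such that for all $a,b,c\in Q$: $a*a=a$; $(a*b)\bar{*}b=a=(a\bar{*}b)*b$; $(a*b)*c=(a*c)*(b*c)$. A quandle homomorphism is a map preserving $*$ (hence $\bar{*}$). $\mathrm{Inn}(Q)$ is the group of automorphisms of $Q$ generated by the right translations $x\mapsto x*a$ ($a\in Q$); $Q$ is connected if $\mathrm{Inn}(Q)$ acts transitively on $Q$. The adjoint group $\mathrm{Adj}(Q)$ is generated by symbols $\mathrm{adj}(a)$, $a\in Q$, subject to $\mathrm{adj}(a*b)=\mathrm{adj}(b)^{-1}\mathrm{adj}(a)\,\mathrm{adj}(b)$. It acts on $Q$ from the right by quandle automorphisms with $a^{\mathrm{adj}(b)}=a*b$. $\mathrm{Adj}(Q)'$ is the commutator subgroup; for connected $Q$ it equals the kernel of the homomorphism $\varepsilon\colon\mathrm{Adj}(Q)\to\mathbb{Z}$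 with $\varepsilon(\mathrm{adj}(a))=1$ for all $a$. A quandle homomorphism $p\colon\tilde Q\to Q$ is a covering if it is surjective and $p(\tilde y)=p(\tilde z)$ implies $\tilde x*\tilde y=\tilde x*\tilde z$ for all $\tilde x,\tilde y,\tilde z\in\tilde Q$. A pointed covering $p\colon(\tilde Q,\tilde q)\to(Q,q)$ is universal if for each pointed covering $\hat p\colon(\hat Q,\hat q)\to(Q,q)$ there exists a unique quandle homomorphism $\phi\colon\tilde Q\to\hat Q$ with $\phi(\tilde q)=\hat q$ and $\hat p\circ\phi=p$. *)

theory Defs
  imports "HOL-Algebra.Bij" "HOL-Algebra.Generated_Groups"
begin

section \<open>Quandles, homomorphisms, connectedness\<close>

record 'a quandle = "'a partial_object" +
  qmult :: "'a \<Rightarrow> 'a \<Rightarrow> 'a" (infixl \<open>\<star>\<index>\<close> 70)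
  qbar :: "'a \<Rightarrow> 'a \<Rightarrow> 'a" (infixl \<open>\<star>\<inverse>\<index>\<close> 70)

locale quandle =
  fixes Q (structure)
  assumes mult_closed: "\<lbrakk>a \<in> carrier Q; b \<in> carrier Q\<rbrakk> \<Longrightarrow> a \<star> b \<in> carrier Q"
    and bar_closed: "\<lbrakk>a \<in> carrier Q; b \<in> carrier Q\<rbrakk> \<Longrightarrow> a \<star>\<inverse> b \<in> carrier Q"
    and idem: "a \<in> carrier Q \<Longrightarrow> a \<star> a = a"
    and mult_bar: "\<lbrakk>a \<in> carrier Q; b \<in> carrier Q\<rbrakk> \<Longrightarrow> (a \<star> b) \<star>\<inverse> b = a"
    and bar_mult: "\<lbrakk>a \<in> carrier Q; b \<in> carrier Q\<rbrakk> \<Longrightarrow> (a \<star>\<inverse> b) \<star> b = a"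
    and self_distrib: "\<lbrakk>a \<in> carrier Q; b \<in> carrier Q; c \<in> carrier Q\<rbrakk>
      \<Longrightarrow> (a \<star> b) \<star> c = (a \<star> c) \<star> (b \<star> c)"

definition quandle_hom ::
    "('a, 'm) quandle_scheme \<Rightarrow> ('b, 'n) quandle_scheme \<Rightarrow> ('a \<Rightarrow> 'b) set" where
  "quandle_hom P Q = {f \<in> carrier P \<rightarrow> carrier Q.
     \<forall>x \<in> carrier P. \<forall>y \<in> carrier P. f (x \<star>\<^bsub>P\<^esub> y) = f x \<star>\<^bsub>Q\<^esub> f y}"

text \<open>As for \<open>AutoGroup\<close>, automorphisms are extensional functions on the carrier.\<close>

definition quandle_AutoGroup :: "('a, 'm) quandle_scheme \<Rightarrow> ('a \<Rightarrow> 'a) monoid" where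
  "quandle_AutoGroup Q =
     BijGroup (carrier Q) \<lparr>carrier := quandle_hom Q Q \<inter> Bij (carrier Q)\<rparr>"

definition right_translation :: "('a, 'm) quandle_scheme \<Rightarrow> 'a \<Rightarrow> 'a \<Rightarrow> 'a" where
  "right_translation Q a = (\<lambda>x \<in> carrier Q. x \<star>\<^bsub>Q\<^esub> a)"

definition Inn :: "('a, 'm) quandle_scheme \<Rightarrow> ('a \<Rightarrow> 'a) set" where
  "Inn Q = generate (quandle_AutoGroup Q) (right_translation Q ` carrier Q)"

definition connected_quandle :: "('a, 'm) quandle_scheme \<Rightarrow> bool" where
  "connected_quandle Q \<longleftrightarrow> quandle Q \<and>
     (\<forall>x \<in> carrier Q. \<forall>y \<in> carrier Q. \<exists>f \<in> Inn Q. f x = y)"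

section \<open>Groups given by generators and relations\<close>

text \<open>A letter \<open>(x, True)\<close> stands for the generator \<open>x\<close>, and \<open>(x, False)\<close> for its
  formal inverse. A pair \<open>(u, v) \<in> R\<close> is the relation \<open>u = v\<close>.\<close>

type_synonym 'a word = "('a \<times> bool) list"

inductive pres_eq :: "'a set \<Rightarrow> ('a word \<times> 'a word) set \<Rightarrow> 'a word \<Rightarrow> 'a word \<Rightarrow> bool"
  for X R where
    refl: "w \<in> lists (X \<times> UNIV) \<Longrightarrow> pres_eq X R w w"
  | sym: "pres_eq X R u v \<Longrightarrow> pres_eq X R v u"
  | trans: "pres_eq X R u v \<Longrightarrow> pres_eq X R v w \<Longrightarrow> pres_eq X R u w"
  | append: "pres_eq X R u u' \<Longrightarrow> pres_eq X R v v' \<Longrightarrow> pres_eq X R (u @ v) (u' @ v')"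
  | cancel: "x \<in> X \<Longrightarrow> pres_eq X R [(x, s), (x, \<not> s)] []"
  | rel: "(u, v) \<in> R \<Longrightarrow> u \<in> lists (X \<times> UNIV) \<Longrightarrow> v \<in> lists (X \<times> UNIV)
      \<Longrightarrow> pres_eq X R u v"

definition pres_class :: "'a set \<Rightarrow> ('a word \<times> 'a word) set \<Rightarrow> 'a word \<Rightarrow> 'a word set" where
  "pres_class X R w = {v. pres_eq X R w v}"

definition presented_group :: "'a set \<Rightarrow> ('a word \<times> 'a word) set \<Rightarrow> 'a word set monoid" where
  "presented_group X R =
     \<lparr>carrier = pres_class X R ` lists (X \<times> UNIV),
      mult = \<lambda>g h. \<Union>u \<in> g. \<Union>v \<in> h. pres_class X R (u @ v),
      one = pres_class X R []\<rparr>"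

lemma pres_eq_words:
  "pres_eq X R u v \<Longrightarrow> u \<in> lists (X \<times> UNIV) \<and> v \<in> lists (X \<times> UNIV)"
  by (induction rule: pres_eq.induct) auto

lemma pres_class_eq_iff:
  assumes "u \<in> lists (X \<times> UNIV)"
  shows "pres_class X R u = pres_class X R v \<longleftrightarrow> pres_eq X R u v"
  using assms unfolding pres_class_def
  by (blast intro: pres_eq.refl pres_eq.sym pres_eq.trans)

lemma pres_class_mult:
  assumes "u \<in> lists (X \<times> UNIV)" "v \<in> lists (X \<times> UNIV)"
  shows "pres_class X R u \<otimes>\<^bsub>presented_group X R\<^esub> pres_class X R v = pres_class X R (u @ v)"
proof -
  have "pres_class X R (u' @ v') = pres_class X R (u @ v)"
    if "u' \<in> pres_class X R u" "v' \<in> pres_class X R v" for u' v'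
  proof -
    have "pres_eq X R (u @ v) (u' @ v')"
      using that by (simp add: pres_class_def pres_eq.append)
    then show ?thesis using pres_class_eq_iff[of "u @ v" X R "u' @ v'"] assms by simp
  qed
  moreover have "u \<in> pres_class X R u" "v \<in> pres_class X R v"
    using assms by (auto simp: pres_class_def intro: pres_eq.refl)
  ultimately show ?thesis
    unfolding presented_group_def monoid.simps by blast
qed

lemma pres_eq_inverse:
  assumes "w \<in> lists (X \<times> UNIV)"
  shows "pres_eq X R (map (\<lambda>(x, s). (x, \<not> s)) (rev w) @ w) []"
  using assms
proof (induction rule: lists.induct)
  case (Cons l w)
  obtain x s where l: "l = (x, s)" by fastforce
  let ?i = "map (\<lambda>(x, s). (x, \<not> s)) (rev w)"
  have x: "x \<in> X" and w: "w \<in> lists (X \<times> UNIV)"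
    using Cons.hyps l by auto
  have i: "?i \<in> lists (X \<times> UNIV)" using w by auto
  have "pres_eq X R ([(x, \<not> s), (x, s)] @ w) ([] @ w)"
    using pres_eq.cancel[OF x, of R "\<not> s"] w by (intro pres_eq.append pres_eq.refl) auto
  from pres_eq.append[OF pres_eq.refl[OF i] this]
  have "pres_eq X R (?i @ ([(x, \<not> s), (x, s)] @ w)) (?i @ ([] @ w))" .
  then show ?case
    using Cons.IH by (auto simp: l intro: pres_eq.trans)
qed (auto intro: pres_eq.refl)

lemma group_presented_group: "group (presented_group X R)"
proof (rule groupI)
  let ?G = "presented_group X R"
  have car: "carrier ?G = pres_class X R ` lists (X \<times> UNIV)"
    and one: "\<one>\<^bsub>?G\<^esub> = pres_class X R []"
    by (simp_all add: presented_group_def)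
  show "\<one>\<^bsub>?G\<^esub> \<in> carrier ?G" by (auto simp: car one)
  show "x \<otimes>\<^bsub>?G\<^esub> y \<in> carrier ?G" if "x \<in> carrier ?G" "y \<in> carrier ?G" for x y
    using that unfolding car
    by (elim imageE, simp only: pres_class_mult) (intro imageI iffD2[OF append_in_lists_conv] conjI)
  show "x \<otimes>\<^bsub>?G\<^esub> y \<otimes>\<^bsub>?G\<^esub> z = x \<otimes>\<^bsub>?G\<^esub> (y \<otimes>\<^bsub>?G\<^esub> z)"
    if "x \<in> carrier ?G" "y \<in> carrier ?G" "z \<in> carrier ?G" for x y z
    using that unfolding car
    by (elim imageE) (simp only: pres_class_mult append_in_lists_conv simp_thms append_assoc)
  show "\<one>\<^bsub>?G\<^esub> \<otimes>\<^bsub>?G\<^esub> x = x" if "x \<in> carrier ?G" for x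
    using that unfolding car one
    by (elim imageE) (simp only: pres_class_mult lists.Nil append_Nil)
  show "\<exists>y \<in> carrier ?G. y \<otimes>\<^bsub>?G\<^esub> x = \<one>\<^bsub>?G\<^esub>" if "x \<in> carrier ?G" for x
  proof -
    from that[unfolded car] obtain w
      where x: "x = pres_class X R w" and w: "w \<in> lists (X \<times> UNIV)"
      by (rule imageE)
    let ?i = "map (\<lambda>(x, s). (x, \<not> s)) (rev w)"
    have i: "?i \<in> lists (X \<times> UNIV)" using w by auto
    have "?i @ w \<in> lists (X \<times> UNIV)" using i w by simp
    then have "pres_class X R ?i \<otimes>\<^bsub>?G\<^esub> x = \<one>\<^bsub>?G\<^esub>"
      unfolding x one pres_class_mult[OF i w]
      by (simp only: pres_class_eq_iff pres_eq_inverse[OF w])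
    moreover have "pres_class X R ?i \<in> carrier ?G"
      unfolding car using i by (rule imageI)
    ultimately show ?thesis by (rule bexI)
  qed
qed

section \<open>The adjoint group and its action\<close>

definition adj_relations :: "('a, 'm) quandle_scheme \<Rightarrow> ('a word \<times> 'a word) set" where
  "adj_relations Q = {([(a \<star>\<^bsub>Q\<^esub> b, True)], [(b, False), (a, True), (b, True)]) | a b.
     a \<in> carrier Q \<and> b \<in> carrier Q}"

definition Adj :: "('a, 'm) quandle_scheme \<Rightarrow> 'a word set monoid" where
  "Adj Q = presented_group (carrier Q) (adj_relations Q)"

definition adj :: "('a, 'm) quandle_scheme \<Rightarrow> 'a \<Rightarrow> 'a word set" where
  "adj Q a = pres_class (carrier Q) (adj_relations Q) [(a, True)]"

definition word_act :: "('a, 'm) quandle_scheme \<Rightarrow> 'a \<Rightarrow> 'a word \<Rightarrow> 'a" where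
  "word_act Q = foldl (\<lambda>x (b, s). if s then x \<star>\<^bsub>Q\<^esub> b else x \<star>\<inverse>\<^bsub>Q\<^esub> b)"

text \<open>\<open>adj_act Q a g\<close> is $a^g$, for \<open>a\<close> in the carrier of a quandle \<open>Q\<close> and \<open>g\<close> in \<open>Adj Q\<close>.
  All words representing \<open>g\<close> act alike, see \<open>adj_act_class\<close> below, so the image is a singleton.\<close>

definition adj_act :: "('a, 'm) quandle_scheme \<Rightarrow> 'a \<Rightarrow> 'a word set \<Rightarrow> 'a" where
  "adj_act Q a g = the_elem (word_act Q a ` g)"

lemma word_act_simps [simp]:
  "word_act Q x [] = x"
  "word_act Q x ((b, s) # w) = word_act Q (if s then x \<star>\<^bsub>Q\<^esub> b else x \<star>\<inverse>\<^bsub>Q\<^esub> b) w"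
  "word_act Q x (u @ v) = word_act Q (word_act Q x u) v"
  by (simp_all add: word_act_def)

context quandle
begin

lemma word_act_closed:
  "w \<in> lists (carrier Q \<times> UNIV) \<Longrightarrow> x \<in> carrier Q \<Longrightarrow> word_act Q x w \<in> carrier Q"
  by (induction w arbitrary: x) (auto simp: mult_closed bar_closed)

lemma word_act_cong:
  assumes "pres_eq (carrier Q) (adj_relations Q) u v" "x \<in> carrier Q"
  shows "word_act Q x u = word_act Q x v"
  using assms
proof (induction arbitrary: x rule: pres_eq.induct)
  case (append u u' v v')
  then show ?case using pres_eq_words[OF append.hyps(1)] by (simp add: word_act_closed)
next
  case (cancel y s)
  then show ?case by (simp add: mult_bar bar_mult)
next
  case (rel u v)
  then obtain a b where ab: "a \<in> carrier Q" "b \<in> carrier Q"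
    and uv: "u = [(a \<star> b, True)]" "v = [(b, False), (a, True), (b, True)]"
    by (auto simp: adj_relations_def)
  have "((x \<star>\<inverse> b) \<star> a) \<star> b = ((x \<star>\<inverse> b) \<star> b) \<star> (a \<star> b)"
    using ab rel.prems by (intro self_distrib bar_closed)
  then show ?case using ab rel.prems uv by (simp add: bar_mult)
qed simp_all

lemma adj_act_class:
  assumes "w \<in> lists (carrier Q \<times> UNIV)" "x \<in> carrier Q"
  shows "adj_act Q x (pres_class (carrier Q) (adj_relations Q) w) = word_act Q x w"
proof -
  have "word_act Q x ` pres_class (carrier Q) (adj_relations Q) w = {word_act Q x w}"
  proof (intro equalityI subsetI)
    fix y assume "y \<in> word_act Q x ` pres_class (carrier Q) (adj_relations Q) w"
    then show "y \<in> {word_act Q x w}"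
      using word_act_cong[OF _ assms(2)] by (fastforce simp: pres_class_def)
  next
    fix y assume "y \<in> {word_act Q x w}"
    then show "y \<in> word_act Q x ` pres_class (carrier Q) (adj_relations Q) w"
      using pres_eq.refl[OF assms(1)] by (auto simp: pres_class_def)
  qed
  then show ?thesis by (simp add: adj_act_def)
qed

lemma adj_act_adj: "a \<in> carrier Q \<Longrightarrow> b \<in> carrier Q \<Longrightarrow> adj_act Q a (adj Q b) = a \<star> b"
  unfolding adj_def by (subst adj_act_class) auto

lemma adj_act_one: "a \<in> carrier Q \<Longrightarrow> adj_act Q a \<one>\<^bsub>Adj Q\<^esub> = a"
  unfolding Adj_def presented_group_def by (simp add: adj_act_class)

lemma adj_act_mult:
  assumes "a \<in> carrier Q" "g \<in> carrier (Adj Q)" "h \<in> carrier (Adj Q)"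
  shows "adj_act Q a (g \<otimes>\<^bsub>Adj Q\<^esub> h) = adj_act Q (adj_act Q a g) h"
proof -
  obtain u v where u: "u \<in> lists (carrier Q \<times> UNIV)"
      and v: "v \<in> lists (carrier Q \<times> UNIV)"
      and g: "g = pres_class (carrier Q) (adj_relations Q) u"
      and h: "h = pres_class (carrier Q) (adj_relations Q) v"
    using assms(2,3) by (auto simp: Adj_def presented_group_def)
  have "u @ v \<in> lists (carrier Q \<times> UNIV)" using u v by auto
  then show ?thesis
    using u v assms(1)
    by (simp add: g h Adj_def pres_class_mult adj_act_class word_act_closed)
qed

end

section \<open>Coverings\<close>

definition quandle_covering ::
    "('b, 'n) quandle_scheme \<Rightarrow> ('a, 'm) quandle_scheme \<Rightarrow> ('b \<Rightarrow> 'a) \<Rightarrow> bool" where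
  "quandle_covering P Q p \<longleftrightarrow> quandle P \<and> quandle Q \<and> p \<in> quandle_hom P Q \<and>
     p ` carrier P = carrier Q \<and>
     (\<forall>x \<in> carrier P. \<forall>y \<in> carrier P. \<forall>z \<in> carrier P.
        p y = p z \<longrightarrow> x \<star>\<^bsub>P\<^esub> y = x \<star>\<^bsub>P\<^esub> z)"

definition pointed_quandle_covering ::
    "('b, 'n) quandle_scheme \<Rightarrow> 'b \<Rightarrow> ('a, 'm) quandle_scheme \<Rightarrow> 'a \<Rightarrow> ('b \<Rightarrow> 'a) \<Rightarrow> bool" where
  "pointed_quandle_covering P x Q q p \<longleftrightarrow>
     quandle_covering P Q p \<and> x \<in> carrier P \<and> q \<in> carrier Q \<and> p x = q"

text \<open>The type argument is the type of the elements of the competing coverings; left as a free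
  type variable in a theorem, it ranges over all types. Homomorphisms are taken to be
  extensional so that they are unique as functions and not only on the carrier.\<close>

definition universal_quandle_covering ::
    "'c itself \<Rightarrow> ('b, 'n) quandle_scheme \<Rightarrow> 'b \<Rightarrow> ('a, 'm) quandle_scheme \<Rightarrow> 'a
      \<Rightarrow> ('b \<Rightarrow> 'a) \<Rightarrow> bool" where
  "universal_quandle_covering TYPE('c) P x Q q p \<longleftrightarrow>
     pointed_quandle_covering P x Q q p \<and>
     (\<forall>(P' :: 'c quandle) x' p'. pointed_quandle_covering P' x' Q q p' \<longrightarrow>
        (\<exists>!\<phi>. \<phi> \<in> quandle_hom P P' \<inter> extensional (carrier P) \<and>
             \<phi> x = x' \<and> (\<forall>y \<in> carrier P. p' (\<phi> y) = p y)))"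

definition tilde_quandle ::
    "('a, 'm) quandle_scheme \<Rightarrow> 'a \<Rightarrow> ('a \<times> 'a word set) quandle" where
  "tilde_quandle Q q =
     \<lparr>carrier = {(a, g). a \<in> carrier Q \<and> g \<in> derived (Adj Q) (carrier (Adj Q)) \<and>
        a = adj_act Q q g},
      qmult = \<lambda>(a, g) (b, h).
        (a \<star>\<^bsub>Q\<^esub> b, g \<otimes>\<^bsub>Adj Q\<^esub> inv\<^bsub>Adj Q\<^esub> adj Q a \<otimes>\<^bsub>Adj Q\<^esub> adj Q b),
      qbar = \<lambda>(a, g) (b, h).
        (a \<star>\<inverse>\<^bsub>Q\<^esub> b, g \<otimes>\<^bsub>Adj Q\<^esub> adj Q a \<otimes>\<^bsub>Adj Q\<^esub> inv\<^bsub>Adj Q\<^esub> adj Q b)\<rparr>"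

end

theory Submission
  imports Defs "HOL-Algebra.Elementary_Groups"
begin

text \<open>Let \<open>G = Adj Q\<close>, let \<open>G'\<close> be its derived subgroup, and call \<open>\<Q>\<close> the quandle of pairs
  \<open>(a, g)\<close> with \<open>g \<in> G'\<close> and \<open>a = q\<^sup>g\<close>. The proof runs parallel to the theory of covering spaces,
  with words in the letters \<open>b\<close>, \<open>b\<inverse>\<close> as paths: such a word moves \<open>x\<close> by successively
  applying \<open>_ \<star> b\<close> or \<open>_ \<star>\<inverse> b\<close>. The orbits of \<open>Inn Q\<close> are the sets of points joined by
  words (\<open>Inn_orbit_iff\<close>).

  A covering \<open>p : P \<rightarrow> Q\<close> lets \<open>G\<close> act on \<open>P\<close>: translation by a point of \<open>P\<close> depends only on its
  image in \<open>Q\<close>, so a word over \<open>Q\<close> can be lifted letter by letter, and lifts of equivalent words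
  act alike (\<open>lift_word_act_cong\<close>). Given a pointed covering \<open>(P, x)\<close>, the map
  \<open>(a, g) \<mapsto> x\<^sup>g\<close> is a homomorphism from \<open>\<Q>\<close> over \<open>Q\<close> (\<open>lift_exists\<close>): multiplication by \<open>(b, h)\<close>
  turns \<open>g\<close> into \<open>g adj(a)\<inverse> adj(b)\<close>; here \<open>adj(a)\<inverse>\<close> fixes \<open>x\<^sup>g\<close>, a point over \<open>a\<close>, by idempotence,
  and \<open>adj(b)\<close> acts as translation by any point over \<open>b\<close>, such as \<open>x\<^sup>h\<close>.

  Uniqueness holds for homomorphisms from any connected quandle into a covering, because the
  value at the end of a word is forced by the value at its start (\<open>lift_unique\<close>). What remains is
  that \<open>\<Q>\<close> is connected. If the lift to \<open>\<Q>\<close> of a word \<open>w\<close> starts at \<open>(q, 1)\<close> and ends at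
  \<open>(a, g)\<close>, then \<open>adj(q)\<^sup>n g = [w]\<close>, where \<open>n\<close> is the exponent sum of \<open>w\<close> (\<open>tilde_word_act\<close>).
  The exponent sum is a homomorphism from \<open>G\<close> to the integers, so it vanishes on \<open>G'\<close>; hence for
  \<open>(a, g) \<in> \<Q>\<close> every word representing \<open>g\<close> leads from \<open>(q, 1)\<close> to \<open>(a, g)\<close>
  (\<open>connected_tilde\<close>).\<close>

section \<open>Orbits of the inner automorphism group\<close>

context quandle
begin

lemma right_translation_automorphism:
  assumes "a \<in> carrier Q"
  shows "right_translation Q a \<in> quandle_hom Q Q \<inter> Bij (carrier Q)"
proof -
  have "bij_betw (right_translation Q a) (carrier Q) (carrier Q)"
    by (rule bij_betwI[where g = "\<lambda>x. x \<star>\<inverse> a"])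
      (use assms in \<open>auto simp: right_translation_def mult_closed bar_closed mult_bar bar_mult\<close>)
  then show ?thesis
    using assms
    by (auto simp: quandle_hom_def Bij_def right_translation_def mult_closed intro!: self_distrib)
qed

lemma subgroup_automorphisms:
  "subgroup (quandle_hom Q Q \<inter> Bij (carrier Q)) (BijGroup (carrier Q))"
proof (rule subgroup.intro)
  let ?B = "BijGroup (carrier Q)" and ?A = "quandle_hom Q Q \<inter> Bij (carrier Q)"
  show "?A \<subseteq> carrier ?B" by (auto simp: BijGroup_def)
  show "\<one>\<^bsub>?B\<^esub> \<in> ?A"
    by (auto simp: BijGroup_def id_Bij quandle_hom_def mult_closed)
  show "f \<otimes>\<^bsub>?B\<^esub> g \<in> ?A" if "f \<in> ?A" "g \<in> ?A" for f g
  proof -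
    have "compose (carrier Q) f g \<in> quandle_hom Q Q"
      using that by (auto simp: quandle_hom_def compose_def Pi_iff mult_closed)
    then show ?thesis using that by (auto simp: BijGroup_def compose_Bij)
  qed
  show "inv\<^bsub>?B\<^esub> f \<in> ?A" if "f \<in> ?A" for f
  proof -
    have f: "f \<in> Bij (carrier Q)"
      and hom: "\<And>x y. x \<in> carrier Q \<Longrightarrow> y \<in> carrier Q \<Longrightarrow> f (x \<star> y) = f x \<star> f y"
      using that by (auto simp: quandle_hom_def)
    have "inv_into (carrier Q) f (x \<star> y) = inv_into (carrier Q) f x \<star> inv_into (carrier Q) f y"
      if "x \<in> carrier Q" "y \<in> carrier Q" for x y
      by (rule Bij_inv_into_lemma[where g = "qmult Q"]) (use f hom that mult_closed in auto)
    then have "(\<lambda>x\<in>carrier Q. inv_into (carrier Q) f x) \<in> quandle_hom Q Q"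
      using f by (auto simp: quandle_hom_def mult_closed Bij_inv_into_mem)
    then show ?thesis using f by (simp add: inv_BijGroup restrict_inv_into_Bij)
  qed
qed

text \<open>In the group of all bijections an inverse is the inverse function, whereas the inverse of an
  element of the automorphism group depends a priori on the smaller carrier.\<close>

lemma Inn_eq_generate_BijGroup:
  "Inn Q = generate (BijGroup (carrier Q)) (right_translation Q ` carrier Q)"
  unfolding Inn_def quandle_AutoGroup_def
  by (rule group.generate_consistent[OF group_BijGroup image_subsetI subgroup_automorphisms])
    (rule right_translation_automorphism)

lemma inv_right_translation:
  assumes "a \<in> carrier Q"
  shows "inv\<^bsub>BijGroup (carrier Q)\<^esub> (right_translation Q a) = (\<lambda>x\<in>carrier Q. x \<star>\<inverse> a)"
proof -
  have R: "right_translation Q a \<in> Bij (carrier Q)"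
    using right_translation_automorphism[OF assms] by blast
  then have "inj_on (right_translation Q a) (carrier Q)"
    by (auto simp: Bij_def bij_betw_def)
  then have "inv_into (carrier Q) (right_translation Q a) x = x \<star>\<inverse> a" if "x \<in> carrier Q" for x
    by (rule inv_into_f_eq)
      (use assms that in \<open>auto simp: right_translation_def bar_closed bar_mult\<close>)
  then show ?thesis using R by (auto simp: inv_BijGroup)
qed

text \<open>This turns connectedness into a statement about words, on which one can do induction. The
  proof goes through because right translations and their inverses act as letters do.\<close>

lemma Inn_orbit_iff:
  assumes x: "x \<in> carrier Q"
  shows "(\<exists>f \<in> Inn Q. f x = y) \<longleftrightarrow> (\<exists>w \<in> lists (carrier Q \<times> UNIV). word_act Q x w = y)"
proof
  let ?B = "BijGroup (carrier Q)"
  have bij: "f \<in> Bij (carrier Q)" if "f \<in> Inn Q" for f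
  proof -
    have "right_translation Q ` carrier Q \<subseteq> carrier ?B"
      using right_translation_automorphism by (auto simp: BijGroup_def)
    then have "Inn Q \<subseteq> carrier ?B"
      unfolding Inn_eq_generate_BijGroup by (rule group.generate_incl[OF group_BijGroup])
    then show ?thesis using that by (auto simp: BijGroup_def)
  qed
  have "\<forall>x \<in> carrier Q. \<exists>w \<in> lists (carrier Q \<times> UNIV). word_act Q x w = f x" if "f \<in> Inn Q" for f
    using that unfolding Inn_eq_generate_BijGroup
  proof (induction rule: generate.induct)
    case one
    then show ?case by (intro ballI bexI[of _ "[]"]) (auto simp: BijGroup_def)
  next
    case (incl h)
    then obtain a where "a \<in> carrier Q" "h = right_translation Q a" by blast
    then show ?case by (intro ballI bexI[of _ "[(a, True)]"]) (auto simp: right_translation_def)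
  next
    case (inv h)
    then obtain a where "a \<in> carrier Q" "h = right_translation Q a" by blast
    then show ?case by (intro ballI bexI[of _ "[(a, False)]"]) (auto simp: inv_right_translation)
  next
    case (eng f g)
    show ?case
    proof
      fix x assume x: "x \<in> carrier Q"
      then obtain u where u: "u \<in> lists (carrier Q \<times> UNIV)" "word_act Q x u = g x"
        using eng.IH by blast
      have fg: "f \<in> Bij (carrier Q)" "g \<in> Bij (carrier Q)"
        using eng.hyps bij unfolding Inn_eq_generate_BijGroup by auto
      then have "g x \<in> carrier Q" using x Bij_imp_funcset by blast
      then obtain v where v: "v \<in> lists (carrier Q \<times> UNIV)" "word_act Q (g x) v = f (g x)"
        using eng.IH by blast
      show "\<exists>w \<in> lists (carrier Q \<times> UNIV). word_act Q x w = (f \<otimes>\<^bsub>?B\<^esub> g) x"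
        using u v fg x by (intro bexI[of _ "u @ v"]) (auto simp: BijGroup_def compose_def)
    qed
  qed
  then show "\<exists>f \<in> Inn Q. f x = y \<Longrightarrow> \<exists>w \<in> lists (carrier Q \<times> UNIV). word_act Q x w = y"
    using x by blast
  have "\<exists>f \<in> Inn Q. f x = word_act Q x w" if "w \<in> lists (carrier Q \<times> UNIV)" for w
    using that
  proof (induction w rule: rev_induct)
    case Nil
    have "\<one>\<^bsub>?B\<^esub> \<in> Inn Q" unfolding Inn_eq_generate_BijGroup by (rule generate.one)
    moreover have "\<one>\<^bsub>?B\<^esub> x = word_act Q x []" using x by (simp add: BijGroup_def)
    ultimately show ?case by blast
  next
    case (snoc l w)
    obtain b s where l: "l = (b, s)" by fastforce
    have b: "b \<in> carrier Q" and w: "w \<in> lists (carrier Q \<times> UNIV)" using snoc.prems l by auto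
    obtain f where f: "f \<in> Inn Q" "f x = word_act Q x w" using snoc w by blast
    \<comment> \<open>In \<open>BijGroup\<close> the right factor is applied first, so the last letter becomes the left factor.\<close>
    let ?t = "if s then right_translation Q b else inv\<^bsub>?B\<^esub> right_translation Q b"
    have t: "?t \<in> Inn Q"
      using b unfolding Inn_eq_generate_BijGroup by (simp add: generate.incl generate.inv)
    then have "?t \<otimes>\<^bsub>?B\<^esub> f \<in> Inn Q"
      using f unfolding Inn_eq_generate_BijGroup by (blast intro: generate.eng)
    moreover have "(?t \<otimes>\<^bsub>?B\<^esub> f) x = word_act Q x (w @ [l])"
    proof -
      have "(?t \<otimes>\<^bsub>?B\<^esub> f) x = ?t (f x)"
        using bij[OF t] bij[OF f(1)] x by (simp only: BijGroup_def monoid.simps restrict_apply'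
            compose_eq)
      also have "\<dots> = (if s then f x \<star> b else f x \<star>\<inverse> b)"
      proof (cases s)
        case True
        then show ?thesis using f(2) word_act_closed[OF w x] by (simp add: right_translation_def)
      next
        case False
        then show ?thesis using f(2) word_act_closed[OF w x] b by (simp add: inv_right_translation)
      qed
      finally show ?thesis by (simp add: f(2) l)
    qed
    ultimately show ?case by blast
  qed
  then show "\<exists>w \<in> lists (carrier Q \<times> UNIV). word_act Q x w = y \<Longrightarrow> \<exists>f \<in> Inn Q. f x = y"
    by blast
qed

text \<open>Concatenating a word with its reversed formal inverse gives a word that represents the unit of
  the adjoint group, and equivalent words act alike.\<close>

lemma word_act_undo:
  assumes "w \<in> lists (carrier Q \<times> UNIV)" "x \<in> carrier Q"
  shows "word_act Q (word_act Q x w) (map (\<lambda>(b, s). (b, \<not> s)) (rev w)) = x"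
proof -
  let ?i = "map (\<lambda>(b, s). (b, \<not> s)) (rev w)"
  have "map (\<lambda>(b, s). (b, \<not> s)) (rev ?i) = w"
    by (simp add: rev_map comp_def case_prod_beta)
  moreover have "?i \<in> lists (carrier Q \<times> UNIV)" using assms(1) by auto
  ultimately have "pres_eq (carrier Q) (adj_relations Q) (w @ ?i) []"
    using pres_eq_inverse[of ?i] by metis
  then show ?thesis using word_act_cong assms(2) by fastforce
qed

text \<open>To join \<open>x\<close> to \<open>y\<close>, go back along a word that leads from \<open>q\<close> to \<open>x\<close>, then on to \<open>y\<close>.\<close>

lemma connectedI:
  assumes "q \<in> carrier Q"
    and reach: "\<And>y. y \<in> carrier Q \<Longrightarrow> \<exists>w \<in> lists (carrier Q \<times> UNIV). word_act Q q w = y"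
  shows "connected_quandle Q"
  unfolding connected_quandle_def
proof (intro conjI ballI)
  show "quandle Q" by (rule quandle_axioms)
  fix x y assume x: "x \<in> carrier Q" and y: "y \<in> carrier Q"
  obtain u v where u: "u \<in> lists (carrier Q \<times> UNIV)" "word_act Q q u = x"
    and v: "v \<in> lists (carrier Q \<times> UNIV)" "word_act Q q v = y"
    using reach x y by meson
  let ?i = "map (\<lambda>(b, s). (b, \<not> s)) (rev u)"
  have "word_act Q x (?i @ v) = y"
    using word_act_undo[OF u(1) assms(1)] u v by simp
  moreover have "?i @ v \<in> lists (carrier Q \<times> UNIV)" using u v by auto
  ultimately show "\<exists>f \<in> Inn Q. f x = y" using Inn_orbit_iff[OF x] by blast
qed

end

lemma connected_quandle_word_act:
  assumes "connected_quandle Q" "x \<in> carrier Q" "y \<in> carrier Q"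
  obtains w where "w \<in> lists (carrier Q \<times> UNIV)" "word_act Q x w = y"
  using assms quandle.Inn_orbit_iff unfolding connected_quandle_def by metis

section \<open>Words, conjugation and degree in the adjoint group\<close>

lemma Adj_cases:
  assumes "g \<in> carrier (Adj Q)"
  obtains w where "w \<in> lists (carrier Q \<times> UNIV)"
    "g = pres_class (carrier Q) (adj_relations Q) w"
  using assms by (auto simp: Adj_def presented_group_def)

lemma group_Adj: "group (Adj Q)"
  unfolding Adj_def by (rule group_presented_group)

lemma one_Adj: "\<one>\<^bsub>Adj Q\<^esub> = pres_class (carrier Q) (adj_relations Q) []"
  by (simp add: Adj_def presented_group_def)

lemma class_in_Adj:
  "w \<in> lists (carrier Q \<times> UNIV) \<Longrightarrow> pres_class (carrier Q) (adj_relations Q) w \<in> carrier (Adj Q)"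
  by (simp add: Adj_def presented_group_def)

lemma class_append:
  assumes "u \<in> lists (carrier Q \<times> UNIV)" "v \<in> lists (carrier Q \<times> UNIV)"
  shows "pres_class (carrier Q) (adj_relations Q) (u @ v) =
    pres_class (carrier Q) (adj_relations Q) u \<otimes>\<^bsub>Adj Q\<^esub> pres_class (carrier Q) (adj_relations Q) v"
  unfolding Adj_def by (simp add: pres_class_mult[OF assms])

lemma adj_closed [simp]: "a \<in> carrier Q \<Longrightarrow> adj Q a \<in> carrier (Adj Q)"
  unfolding adj_def by (rule class_in_Adj) auto

lemma class_letter:
  assumes "a \<in> carrier Q"
  shows "pres_class (carrier Q) (adj_relations Q) [(a, s)] =
    (if s then adj Q a else inv\<^bsub>Adj Q\<^esub> adj Q a)"
proof (cases s)
  case True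
  then show ?thesis by (simp add: adj_def)
next
  case False
  have "pres_class (carrier Q) (adj_relations Q) [(a, False)] \<otimes>\<^bsub>Adj Q\<^esub> adj Q a = \<one>\<^bsub>Adj Q\<^esub>"
  proof -
    have "pres_eq (carrier Q) (adj_relations Q) [(a, False), (a, True)] []"
      using pres_eq.cancel[OF assms, of "adj_relations Q" False] by simp
    then show ?thesis
      using assms class_append[of "[(a, False)]" Q "[(a, True)]"]
        pres_class_eq_iff[of "[(a, False), (a, True)]" "carrier Q" "adj_relations Q" "[]"]
      by (simp add: adj_def one_Adj)
  qed
  then have "inv\<^bsub>Adj Q\<^esub> adj Q a = pres_class (carrier Q) (adj_relations Q) [(a, False)]"
    by (rule group.inv_equality[OF group_Adj]) (use assms in \<open>auto intro: class_in_Adj\<close>)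
  then show ?thesis using False by simp
qed

lemma (in group) inv_mult_cancel:
  assumes "x \<in> carrier G" "y \<in> carrier G"
  shows "inv x \<otimes> (x \<otimes> y) = y" "x \<otimes> (inv x \<otimes> y) = y"
  using assms by (simp_all add: m_assoc[symmetric])

context quandle
begin

interpretation Adj: group "Adj Q" by (rule group_Adj)

lemma adj_mult:
  assumes "a \<in> carrier Q" "b \<in> carrier Q"
  shows "adj Q (a \<star> b) = inv\<^bsub>Adj Q\<^esub> adj Q b \<otimes>\<^bsub>Adj Q\<^esub> adj Q a \<otimes>\<^bsub>Adj Q\<^esub> adj Q b"
proof -
  have "pres_eq (carrier Q) (adj_relations Q) [(a \<star> b, True)] [(b, False), (a, True), (b, True)]"
    by (rule pres_eq.rel) (use assms in \<open>auto simp: adj_relations_def mult_closed\<close>)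
  then have "adj Q (a \<star> b) =
      pres_class (carrier Q) (adj_relations Q) ([(b, False)] @ [(a, True)] @ [(b, True)])"
    unfolding adj_def by (subst pres_class_eq_iff) (use assms in \<open>auto simp: mult_closed\<close>)
  also have "\<dots> = inv\<^bsub>Adj Q\<^esub> adj Q b \<otimes>\<^bsub>Adj Q\<^esub> (adj Q a \<otimes>\<^bsub>Adj Q\<^esub> adj Q b)"
    using assms by (simp only: class_append class_letter append_in_lists_conv lists.Cons lists.Nil
      mem_Sigma_iff UNIV_I simp_thms if_True if_False Cons_in_lists_iff)
  finally show ?thesis using assms by (simp add: Adj.m_assoc)
qed

lemma adj_bar:
  assumes "a \<in> carrier Q" "b \<in> carrier Q"
  shows "adj Q (a \<star>\<inverse> b) = adj Q b \<otimes>\<^bsub>Adj Q\<^esub> adj Q a \<otimes>\<^bsub>Adj Q\<^esub> inv\<^bsub>Adj Q\<^esub> adj Q b"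
proof -
  have "adj Q a = inv\<^bsub>Adj Q\<^esub> adj Q b \<otimes>\<^bsub>Adj Q\<^esub> adj Q (a \<star>\<inverse> b) \<otimes>\<^bsub>Adj Q\<^esub> adj Q b"
    using adj_mult[of "a \<star>\<inverse> b" b] assms by (simp add: bar_closed bar_mult)
  then show ?thesis
    using assms by (simp add: bar_closed Adj.m_assoc Adj.inv_mult_cancel)
qed

text \<open>Equivariance of \<open>adj\<close>: the defining relations make \<open>adj (a \<star> b)\<close> a conjugate of \<open>adj a\<close>, and
  the conjugating elements accumulate along a word.\<close>

lemma adj_word_act:
  assumes "w \<in> lists (carrier Q \<times> UNIV)" "x \<in> carrier Q"
  shows "adj Q (word_act Q x w) =
    inv\<^bsub>Adj Q\<^esub> (pres_class (carrier Q) (adj_relations Q) w) \<otimes>\<^bsub>Adj Q\<^esub> adj Q x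
      \<otimes>\<^bsub>Adj Q\<^esub> pres_class (carrier Q) (adj_relations Q) w"
  using assms
proof (induction w arbitrary: x rule: lists.induct)
  case Nil
  then show ?case by (simp add: one_Adj[symmetric])
next
  case (Cons l w)
  obtain b s where l: "l = (b, s)" by fastforce
  have b: "b \<in> carrier Q" using Cons.hyps l by auto
  let ?c = "pres_class (carrier Q) (adj_relations Q)"
  have "?c (l # w) = ?c [l] \<otimes>\<^bsub>Adj Q\<^esub> ?c w"
    using class_append[of "[l]" Q w] Cons.hyps by simp
  then show ?case
    using b Cons class_in_Adj[OF Cons.hyps(2)]
    by (simp add: l class_letter mult_closed bar_closed adj_mult adj_bar Adj.m_assoc
        Adj.inv_mult_group)
qed

lemma adj_act_inv_adj:
  assumes "a \<in> carrier Q" "b \<in> carrier Q"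
  shows "adj_act Q a (inv\<^bsub>Adj Q\<^esub> adj Q b) = a \<star>\<inverse> b"
proof -
  have "adj_act Q a (inv\<^bsub>Adj Q\<^esub> adj Q b) = word_act Q a [(b, False)]"
    using class_letter[OF assms(2), of False] adj_act_class[of "[(b, False)]" a] assms by simp
  then show ?thesis by simp
qed

end

definition exponent_sum :: "'a word \<Rightarrow> int" where
  "exponent_sum w = (\<Sum>(x, s)\<leftarrow>w. if s then 1 else -1)"

lemma exponent_sum_simps [simp]:
  "exponent_sum [] = 0"
  "exponent_sum ((x, s) # w) = (if s then 1 else -1) + exponent_sum w"
  "exponent_sum (u @ v) = exponent_sum u + exponent_sum v"
  by (simp_all add: exponent_sum_def)

text \<open>Both sides of every defining relation \<open>adj (a \<star> b) = (adj b)\<inverse> (adj a) (adj b)\<close> have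
  exponent sum 1.\<close>

lemma exponent_sum_cong:
  "pres_eq (carrier Q) (adj_relations Q) u v \<Longrightarrow> exponent_sum u = exponent_sum v"
  by (induction rule: pres_eq.induct) (auto simp: adj_relations_def)

text \<open>This is the homomorphism $\varepsilon$ that sends every \<open>adj a\<close> to 1; the image of a class under
  the exponent sum is a singleton by \<open>exponent_sum_cong\<close>.\<close>

definition Adj_degree :: "'a word set \<Rightarrow> int" where
  "Adj_degree g = the_elem (exponent_sum ` g)"

lemma Adj_degree_class:
  assumes "w \<in> lists (carrier Q \<times> UNIV)"
  shows "Adj_degree (pres_class (carrier Q) (adj_relations Q) w) = exponent_sum w"
proof -
  have "exponent_sum ` pres_class (carrier Q) (adj_relations Q) w = {exponent_sum w}"
    using exponent_sum_cong pres_eq.refl[OF assms] by (fastforce simp: pres_class_def)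
  then show ?thesis by (simp add: Adj_degree_def)
qed

lemma Adj_degree_hom: "Adj_degree \<in> hom (Adj Q) integer_group"
proof (rule homI)
  fix g h assume g: "g \<in> carrier (Adj Q)" and h: "h \<in> carrier (Adj Q)"
  obtain u where u: "u \<in> lists (carrier Q \<times> UNIV)" "g = pres_class (carrier Q) (adj_relations Q) u"
    using g by (rule Adj_cases)
  obtain v where v: "v \<in> lists (carrier Q \<times> UNIV)" "h = pres_class (carrier Q) (adj_relations Q) v"
    using h by (rule Adj_cases)
  have "u @ v \<in> lists (carrier Q \<times> UNIV)" using u v by simp
  then show "Adj_degree (g \<otimes>\<^bsub>Adj Q\<^esub> h) = Adj_degree g \<otimes>\<^bsub>integer_group\<^esub> Adj_degree h"
    using u v by (simp add: class_append[symmetric] Adj_degree_class)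
qed simp

text \<open>The derived subgroup is mapped onto the derived subgroup of the image, which is trivial because
  the integers are commutative.\<close>

lemma Adj_degree_derived:
  assumes "g \<in> derived (Adj Q) (carrier (Adj Q))"
  shows "Adj_degree g = 0"
proof -
  interpret group_hom "Adj Q" integer_group Adj_degree
    by (intro group_hom.intro group_hom_axioms.intro group_Adj group_integer_group Adj_degree_hom)
  interpret Z: comm_group integer_group by (rule abelian_integer_group)
  have "Adj_degree ` derived (Adj Q) (carrier (Adj Q)) =
      derived integer_group (Adj_degree ` carrier (Adj Q))"
    by (rule derived_img[symmetric]) simp
  also have "\<dots> = {0}" using Z.derived_eq_singleton by simp
  finally show ?thesis using assms by auto
qed

section \<open>Coverings and the lifted action of the adjoint group\<close>

lemma quandle_hom_closed:
  "f \<in> quandle_hom P Q \<Longrightarrow> x \<in> carrier P \<Longrightarrow> f x \<in> carrier Q"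
  by (auto simp: quandle_hom_def)

lemma quandle_hom_mult:
  "f \<in> quandle_hom P Q \<Longrightarrow> x \<in> carrier P \<Longrightarrow> y \<in> carrier P \<Longrightarrow> f (x \<star>\<^bsub>P\<^esub> y) = f x \<star>\<^bsub>Q\<^esub> f y"
  by (auto simp: quandle_hom_def)

lemma quandle_hom_bar:
  assumes "quandle P" "quandle Q" "f \<in> quandle_hom P Q" "x \<in> carrier P" "y \<in> carrier P"
  shows "f (x \<star>\<inverse>\<^bsub>P\<^esub> y) = f x \<star>\<inverse>\<^bsub>Q\<^esub> f y"
proof -
  interpret P: quandle P by fact
  interpret Q: quandle Q by fact
  have "f (x \<star>\<inverse>\<^bsub>P\<^esub> y) \<star>\<^bsub>Q\<^esub> f y = f x"
    using assms by (metis P.bar_closed P.bar_mult quandle_hom_mult)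
  then show ?thesis using assms by (metis P.bar_closed Q.mult_bar quandle_hom_closed)
qed

lemma quandle_hom_word_act:
  assumes "quandle P" "quandle Q" "f \<in> quandle_hom P Q"
    and "x \<in> carrier P" "w \<in> lists (carrier P \<times> UNIV)"
  shows "f (word_act P x w) = word_act Q (f x) (map (apfst f) w)"
  using assms(5,4)
proof (induction w arbitrary: x rule: lists.induct)
  case (Cons l w)
  then show ?case
    using assms(1-3) by (cases l)
      (auto simp: quandle_hom_mult quandle_hom_bar quandle.mult_closed quandle.bar_closed)
qed simp

locale covering =
  fixes P :: "('b, 'n) quandle_scheme" and Q :: "('a, 'm) quandle_scheme" and p
  assumes covering: "quandle_covering P Q p"
begin

sublocale P: quandle P using covering by (simp add: quandle_covering_def)
sublocale Q: quandle Q using covering by (simp add: quandle_covering_def)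

lemma covering_hom: "p \<in> quandle_hom P Q"
  using covering by (simp add: quandle_covering_def)

lemma mult_fibre:
  "\<lbrakk>x \<in> carrier P; y \<in> carrier P; z \<in> carrier P; p y = p z\<rbrakk> \<Longrightarrow> x \<star>\<^bsub>P\<^esub> y = x \<star>\<^bsub>P\<^esub> z"
  using covering unfolding quandle_covering_def by blast

text \<open>The covering condition speaks of \<open>\<star>\<close> only; the same independence for \<open>\<star>\<inverse>\<close> follows since
  both translations are inverse to those by \<open>y\<close> and \<open>z\<close>, which agree.\<close>

lemma bar_fibre:
  assumes "x \<in> carrier P" "y \<in> carrier P" "z \<in> carrier P" "p y = p z"
  shows "x \<star>\<inverse>\<^bsub>P\<^esub> y = x \<star>\<inverse>\<^bsub>P\<^esub> z"
proof -
  have "(x \<star>\<inverse>\<^bsub>P\<^esub> y) \<star>\<^bsub>P\<^esub> z = x"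
    using mult_fibre[of "x \<star>\<inverse>\<^bsub>P\<^esub> y" y z] assms by (simp add: P.bar_closed P.bar_mult)
  then show ?thesis using P.mult_bar[of "x \<star>\<inverse>\<^bsub>P\<^esub> y" z] assms by (simp add: P.bar_closed)
qed

text \<open>Unique lifting. Two lifts that agree at a point \<open>r\<close> agree at \<open>r \<star> b\<close>: their values at \<open>b\<close> may
  differ, but lie in the same fibre and therefore translate alike. Connectedness spreads the
  agreement from the base point to all of \<open>R\<close>.\<close>

theorem lift_unique:
  assumes R: "connected_quandle R" "r \<in> carrier R"
    and f: "f \<in> quandle_hom R P" and g: "g \<in> quandle_hom R P"
    and base: "f r = g r" and over: "\<And>y. y \<in> carrier R \<Longrightarrow> p (f y) = p (g y)"
    and y: "y \<in> carrier R"
  shows "f y = g y"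
proof -
  have qR: "quandle R" using R by (simp add: connected_quandle_def)
  interpret R: quandle R by (rule qR)
  obtain w where w: "w \<in> lists (carrier R \<times> UNIV)" "word_act R r w = y"
    using connected_quandle_word_act R y by metis
  have "f (word_act R r w) = g (word_act R r w)"
    using w(1) R(2) base
  proof (induction w arbitrary: r rule: lists.induct)
    case (Cons l w)
    obtain b s where l: "l = (b, s)" by fastforce
    let ?r = "if s then r \<star>\<^bsub>R\<^esub> b else r \<star>\<inverse>\<^bsub>R\<^esub> b"
    have b: "b \<in> carrier R" using Cons.hyps l by auto
    have "?r \<in> carrier R" using b Cons.prems by (simp add: R.mult_closed R.bar_closed)
    moreover have "f ?r = g ?r"
      using b Cons.prems f g over[OF b] mult_fibre[of "g r" "f b" "g b"]
        bar_fibre[of "g r" "f b" "g b"]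
      by (simp add: quandle_hom_mult quandle_hom_bar[OF qR P.quandle_axioms] quandle_hom_closed)
    ultimately have "f (word_act R ?r w) = g (word_act R ?r w)" by (rule Cons.IH)
    then show ?case by (simp only: l word_act_simps)
  qed simp
  then show ?thesis using w by simp
qed

text \<open>A set-theoretic section of \<open>p\<close> is applied to each letter. Any choice of preimages gives the same
  action, by \<open>mult_fibre\<close> and \<open>bar_fibre\<close>.\<close>

definition lift_word :: "'a word \<Rightarrow> 'b word" where
  "lift_word = map (apfst (inv_into (carrier P) p))"

text \<open>The action of \<open>Adj Q\<close> on \<open>P\<close>. All words in the class \<open>g\<close> act alike, see \<open>lift_act_class\<close>, so the
  image is a singleton.\<close>

definition lift_act :: "'b \<Rightarrow> 'a word set \<Rightarrow> 'b" where
  "lift_act x g = the_elem ((\<lambda>w. word_act P x (lift_word w)) ` g)"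

lemma inv_into_fibre:
  assumes "b \<in> carrier Q"
  shows "inv_into (carrier P) p b \<in> carrier P" "p (inv_into (carrier P) p b) = b"
proof -
  have "b \<in> p ` carrier P" using assms covering by (simp add: quandle_covering_def)
  then show "inv_into (carrier P) p b \<in> carrier P" "p (inv_into (carrier P) p b) = b"
    by (rule inv_into_into, rule f_inv_into_f)
qed

lemma lift_word_simps [simp]:
  "lift_word [] = []"
  "lift_word ((b, s) # w) = (inv_into (carrier P) p b, s) # lift_word w"
  "lift_word (u @ v) = lift_word u @ lift_word v"
  by (simp_all add: lift_word_def)

lemma lift_word_closed:
  "w \<in> lists (carrier Q \<times> UNIV) \<Longrightarrow> lift_word w \<in> lists (carrier P \<times> UNIV)"
  by (induction w) (auto simp: inv_into_fibre)

lemma project_lift_word: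
  "w \<in> lists (carrier Q \<times> UNIV) \<Longrightarrow> map (apfst p) (lift_word w) = w"
  by (induction w) (auto simp: inv_into_fibre)

lemma lift_word_act_closed:
  "w \<in> lists (carrier Q \<times> UNIV) \<Longrightarrow> x \<in> carrier P \<Longrightarrow> word_act P x (lift_word w) \<in> carrier P"
  by (simp add: lift_word_closed P.word_act_closed)

lemma project_lift_word_act:
  assumes "w \<in> lists (carrier Q \<times> UNIV)" "x \<in> carrier P"
  shows "p (word_act P x (lift_word w)) = word_act Q (p x) w"
  using quandle_hom_word_act[OF P.quandle_axioms Q.quandle_axioms covering_hom assms(2)] assms
  by (simp add: lift_word_closed project_lift_word)

text \<open>A relation of the adjoint group is respected because the chosen preimage of \<open>a \<star> b\<close> lies in the
  same fibre as the product of the chosen preimages of \<open>a\<close> and \<open>b\<close>; for that product, the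
  relation is self-distributivity in \<open>P\<close>.\<close>

lemma lift_word_act_cong:
  assumes "pres_eq (carrier Q) (adj_relations Q) u v" "x \<in> carrier P"
  shows "word_act P x (lift_word u) = word_act P x (lift_word v)"
  using assms
proof (induction arbitrary: x rule: pres_eq.induct)
  case (append u u' v v')
  then show ?case using pres_eq_words[OF append.hyps(1)] by (simp add: lift_word_act_closed)
next
  case (cancel y s)
  then show ?case by (simp add: P.mult_bar P.bar_mult inv_into_fibre)
next
  case (rel u v)
  then obtain a b where ab: "a \<in> carrier Q" "b \<in> carrier Q"
    and uv: "u = [(a \<star>\<^bsub>Q\<^esub> b, True)]" "v = [(b, False), (a, True), (b, True)]"
    by (auto simp: adj_relations_def)
  define a' b' c' where
    "a' = inv_into (carrier P) p a" and "b' = inv_into (carrier P) p b" and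
    "c' = inv_into (carrier P) p (a \<star>\<^bsub>Q\<^esub> b)"
  have mem: "a' \<in> carrier P" "b' \<in> carrier P" "c' \<in> carrier P"
    and "p a' = a" "p b' = b" "p c' = a \<star>\<^bsub>Q\<^esub> b"
    using ab by (auto simp: inv_into_fibre a'_def b'_def c'_def Q.mult_closed)
  then have "p c' = p (a' \<star>\<^bsub>P\<^esub> b')" by (simp add: quandle_hom_mult[OF covering_hom])
  then have "x \<star>\<^bsub>P\<^esub> c' = x \<star>\<^bsub>P\<^esub> (a' \<star>\<^bsub>P\<^esub> b')"
    using mem rel.prems by (intro mult_fibre P.mult_closed)
  also have "\<dots> = ((x \<star>\<inverse>\<^bsub>P\<^esub> b') \<star>\<^bsub>P\<^esub> b') \<star>\<^bsub>P\<^esub> (a' \<star>\<^bsub>P\<^esub> b')"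
    using mem rel.prems by (simp add: P.bar_mult)
  also have "\<dots> = ((x \<star>\<inverse>\<^bsub>P\<^esub> b') \<star>\<^bsub>P\<^esub> a') \<star>\<^bsub>P\<^esub> b'"
    using mem rel.prems by (intro P.self_distrib[symmetric] P.bar_closed)
  finally show ?case using uv by (simp add: a'_def b'_def c'_def)
qed simp_all

lemma lift_act_class:
  assumes "w \<in> lists (carrier Q \<times> UNIV)" "x \<in> carrier P"
  shows "lift_act x (pres_class (carrier Q) (adj_relations Q) w) = word_act P x (lift_word w)"
proof -
  have "(\<lambda>w. word_act P x (lift_word w)) ` pres_class (carrier Q) (adj_relations Q) w
      = {word_act P x (lift_word w)}"
    using lift_word_act_cong[OF _ assms(2)] pres_eq.refl[OF assms(1)]
    by (fastforce simp: pres_class_def)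
  then show ?thesis by (simp add: lift_act_def)
qed

lemma lift_act_closed: "g \<in> carrier (Adj Q) \<Longrightarrow> x \<in> carrier P \<Longrightarrow> lift_act x g \<in> carrier P"
  by (erule Adj_cases) (simp add: lift_act_class lift_word_act_closed)

lemma project_lift_act:
  "g \<in> carrier (Adj Q) \<Longrightarrow> x \<in> carrier P \<Longrightarrow> p (lift_act x g) = adj_act Q (p x) g"
  by (erule Adj_cases)
    (simp add: lift_act_class project_lift_word_act Q.adj_act_class quandle_hom_closed[OF covering_hom])

lemma lift_act_one: "x \<in> carrier P \<Longrightarrow> lift_act x \<one>\<^bsub>Adj Q\<^esub> = x"
  by (simp add: one_Adj lift_act_class)

lemma lift_act_mult:
  assumes "g \<in> carrier (Adj Q)" "h \<in> carrier (Adj Q)" "x \<in> carrier P"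
  shows "lift_act x (g \<otimes>\<^bsub>Adj Q\<^esub> h) = lift_act (lift_act x g) h"
proof -
  obtain u where u: "u \<in> lists (carrier Q \<times> UNIV)" "g = pres_class (carrier Q) (adj_relations Q) u"
    using assms(1) by (rule Adj_cases)
  obtain v where v: "v \<in> lists (carrier Q \<times> UNIV)" "h = pres_class (carrier Q) (adj_relations Q) v"
    using assms(2) by (rule Adj_cases)
  have "u @ v \<in> lists (carrier Q \<times> UNIV)" using u v by simp
  then show ?thesis
    using u v assms(3)
    by (simp add: class_append[symmetric] lift_act_class lift_word_act_closed)
qed

lemma lift_act_adj:
  assumes "x \<in> carrier P" "y \<in> carrier P"
  shows "lift_act x (adj Q (p y)) = x \<star>\<^bsub>P\<^esub> y"
proof -
  have "p y \<in> carrier Q" using assms by (simp add: quandle_hom_closed[OF covering_hom])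
  then show ?thesis
    using assms inv_into_fibre[of "p y"] mult_fibre[of x "inv_into (carrier P) p (p y)" y]
    by (simp add: adj_def lift_act_class)
qed

text \<open>Translation by a point \<open>x\<close> fixes \<open>x\<close>, and it is the action of \<open>adj (p x)\<close>. This is what absorbs
  the factor \<open>(adj a)\<inverse>\<close> in the multiplication of the universal covering.\<close>

lemma lift_act_inv_adj_self:
  assumes "x \<in> carrier P"
  shows "lift_act x (inv\<^bsub>Adj Q\<^esub> adj Q (p x)) = x"
proof -
  interpret A: group "Adj Q" by (rule group_Adj)
  have a: "adj Q (p x) \<in> carrier (Adj Q)" using assms by (simp add: quandle_hom_closed[OF covering_hom])
  have "lift_act x (adj Q (p x)) = x" using assms by (simp add: lift_act_adj P.idem)
  then show ?thesis
    using lift_act_mult[of "adj Q (p x)" "inv\<^bsub>Adj Q\<^esub> adj Q (p x)" x] assms a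
    by (simp add: lift_act_one)
qed

end

section \<open>The quandle of pairs\<close>

locale pointed_connected_quandle = quandle Q for Q (structure) +
  fixes q
  assumes connected: "connected_quandle Q" and base: "q \<in> carrier Q"
begin

interpretation Adj: group "Adj Q" by (rule group_Adj)

abbreviation Adj' where "Adj' \<equiv> derived (Adj Q) (carrier (Adj Q))"
abbreviation tilde (\<open>\<Q>\<close>) where "\<Q> \<equiv> tilde_quandle Q q"

lemma Adj'_subgroup: "subgroup Adj' (Adj Q)"
  by (rule Adj.derived_is_subgroup) simp

lemma Adj'_closed: "g \<in> Adj' \<Longrightarrow> g \<in> carrier (Adj Q)"
  using subgroup.mem_carrier[OF Adj'_subgroup] .

lemma commutator_in_Adj':
  assumes "g \<in> carrier (Adj Q)" "h \<in> carrier (Adj Q)"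
  shows "g \<otimes>\<^bsub>Adj Q\<^esub> h \<otimes>\<^bsub>Adj Q\<^esub> inv\<^bsub>Adj Q\<^esub> g \<otimes>\<^bsub>Adj Q\<^esub> inv\<^bsub>Adj Q\<^esub> h \<in> Adj'"
  unfolding derived_def by (rule generate.incl) (use assms in blast)

text \<open>By connectedness \<open>adj b\<close> is a conjugate of \<open>adj a\<close>, and quotients of conjugate elements are
  commutators. So the multiplication of pairs does not leave the derived subgroup.\<close>

lemma adj_quotient_in_Adj':
  assumes a: "a \<in> carrier Q" and b: "b \<in> carrier Q"
  shows "inv\<^bsub>Adj Q\<^esub> adj Q a \<otimes>\<^bsub>Adj Q\<^esub> adj Q b \<in> Adj'"
    and "adj Q a \<otimes>\<^bsub>Adj Q\<^esub> inv\<^bsub>Adj Q\<^esub> adj Q b \<in> Adj'"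
proof -
  obtain w where w: "w \<in> lists (carrier Q \<times> UNIV)" "word_act Q a w = b"
    using connected_quandle_word_act[OF connected a b] .
  let ?g = "pres_class (carrier Q) (adj_relations Q) w"
  have g: "?g \<in> carrier (Adj Q)" using w by (rule_tac class_in_Adj)
  have b_eq: "adj Q b = inv\<^bsub>Adj Q\<^esub> ?g \<otimes>\<^bsub>Adj Q\<^esub> adj Q a \<otimes>\<^bsub>Adj Q\<^esub> ?g"
    using adj_word_act[OF w(1) a] w(2) by simp
  show "inv\<^bsub>Adj Q\<^esub> adj Q a \<otimes>\<^bsub>Adj Q\<^esub> adj Q b \<in> Adj'"
    using commutator_in_Adj'[of "inv\<^bsub>Adj Q\<^esub> adj Q a" "inv\<^bsub>Adj Q\<^esub> ?g"] a g
    by (simp add: b_eq Adj.m_assoc)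
  show "adj Q a \<otimes>\<^bsub>Adj Q\<^esub> inv\<^bsub>Adj Q\<^esub> adj Q b \<in> Adj'"
    using commutator_in_Adj'[of "adj Q a" "inv\<^bsub>Adj Q\<^esub> ?g"] a g
    by (simp add: b_eq Adj.m_assoc Adj.inv_mult_group)
qed

lemma tilde_carrier:
  "(a, g) \<in> carrier \<Q> \<longleftrightarrow> a \<in> carrier Q \<and> g \<in> Adj' \<and> a = adj_act Q q g"
  by (simp add: tilde_quandle_def)

lemma tilde_ops [simp]:
  "(a, g) \<star>\<^bsub>\<Q>\<^esub> (b, h) = (a \<star> b, g \<otimes>\<^bsub>Adj Q\<^esub> inv\<^bsub>Adj Q\<^esub> adj Q a \<otimes>\<^bsub>Adj Q\<^esub> adj Q b)"
  "(a, g) \<star>\<inverse>\<^bsub>\<Q>\<^esub> (b, h) = (a \<star>\<inverse> b, g \<otimes>\<^bsub>Adj Q\<^esub> adj Q a \<otimes>\<^bsub>Adj Q\<^esub> inv\<^bsub>Adj Q\<^esub> adj Q b)"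
  by (simp_all add: tilde_quandle_def)

lemma tilde_mult_closed:
  assumes "(a, g) \<in> carrier \<Q>" "b \<in> carrier Q"
  shows "(a \<star> b, g \<otimes>\<^bsub>Adj Q\<^esub> inv\<^bsub>Adj Q\<^esub> adj Q a \<otimes>\<^bsub>Adj Q\<^esub> adj Q b) \<in> carrier \<Q>"
proof -
  have ag: "a \<in> carrier Q" "g \<in> Adj'" "adj_act Q q g = a"
    using assms(1) by (auto simp: tilde_carrier)
  have "a \<star>\<inverse> a = a" using mult_bar[of a a] ag by (simp add: idem)
  then have "adj_act Q q (g \<otimes>\<^bsub>Adj Q\<^esub> inv\<^bsub>Adj Q\<^esub> adj Q a \<otimes>\<^bsub>Adj Q\<^esub> adj Q b) = a \<star> b"
    using ag assms(2) base by (simp add: Adj'_closed adj_act_mult adj_act_inv_adj adj_act_adj)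
  moreover have "g \<otimes>\<^bsub>Adj Q\<^esub> inv\<^bsub>Adj Q\<^esub> adj Q a \<otimes>\<^bsub>Adj Q\<^esub> adj Q b \<in> Adj'"
    using subgroup.m_closed[OF Adj'_subgroup ag(2) adj_quotient_in_Adj'(1)[OF ag(1) assms(2)]]
      ag assms(2) by (simp add: Adj.m_assoc Adj'_closed)
  ultimately show ?thesis using ag assms(2) by (simp add: tilde_carrier mult_closed)
qed

lemma tilde_bar_closed:
  assumes "(a, g) \<in> carrier \<Q>" "b \<in> carrier Q"
  shows "(a \<star>\<inverse> b, g \<otimes>\<^bsub>Adj Q\<^esub> adj Q a \<otimes>\<^bsub>Adj Q\<^esub> inv\<^bsub>Adj Q\<^esub> adj Q b) \<in> carrier \<Q>"
proof -
  have ag: "a \<in> carrier Q" "g \<in> Adj'" "adj_act Q q g = a"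
    using assms(1) by (auto simp: tilde_carrier)
  then have "adj_act Q q (g \<otimes>\<^bsub>Adj Q\<^esub> adj Q a \<otimes>\<^bsub>Adj Q\<^esub> inv\<^bsub>Adj Q\<^esub> adj Q b) = a \<star>\<inverse> b"
    using assms(2) base by (simp add: Adj'_closed adj_act_mult adj_act_inv_adj adj_act_adj idem)
  moreover have "g \<otimes>\<^bsub>Adj Q\<^esub> adj Q a \<otimes>\<^bsub>Adj Q\<^esub> inv\<^bsub>Adj Q\<^esub> adj Q b \<in> Adj'"
    using subgroup.m_closed[OF Adj'_subgroup ag(2) adj_quotient_in_Adj'(2)[OF ag(1) assms(2)]]
      ag assms(2) by (simp add: Adj.m_assoc Adj'_closed)
  ultimately show ?thesis using ag assms(2) by (simp add: tilde_carrier bar_closed)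
qed

text \<open>In the first component the axioms are those of \<open>Q\<close>; in the second they become identities in the
  group once \<open>adj (a \<star> b)\<close> and \<open>adj (a \<star>\<inverse> b)\<close> are written as conjugates.\<close>

lemma quandle_tilde: "quandle \<Q>"
proof
  fix x y z assume xyz: "x \<in> carrier \<Q>" "y \<in> carrier \<Q>" "z \<in> carrier \<Q>"
  obtain a g b h c k where e: "x = (a, g)" "y = (b, h)" "z = (c, k)" by (metis surj_pair)
  have car: "a \<in> carrier Q" "b \<in> carrier Q" "c \<in> carrier Q" "g \<in> carrier (Adj Q)"
    using xyz by (auto simp: e tilde_carrier Adj'_closed)
  note group_simps = Adj.m_assoc Adj.inv_mult_group Adj.inv_mult_cancel adj_mult adj_bar
    mult_closed bar_closed
  show "x \<star>\<^bsub>\<Q>\<^esub> y \<in> carrier \<Q>" "x \<star>\<inverse>\<^bsub>\<Q>\<^esub> y \<in> carrier \<Q>"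
    using xyz car by (auto simp: e tilde_mult_closed tilde_bar_closed)
  show "x \<star>\<^bsub>\<Q>\<^esub> x = x"
    using car by (simp add: e idem group_simps)
  show "(x \<star>\<^bsub>\<Q>\<^esub> y) \<star>\<inverse>\<^bsub>\<Q>\<^esub> y = x"
    using car by (simp add: e mult_bar group_simps)
  show "(x \<star>\<inverse>\<^bsub>\<Q>\<^esub> y) \<star>\<^bsub>\<Q>\<^esub> y = x"
    using car by (simp add: e bar_mult group_simps)
  show "(x \<star>\<^bsub>\<Q>\<^esub> y) \<star>\<^bsub>\<Q>\<^esub> z = (x \<star>\<^bsub>\<Q>\<^esub> z) \<star>\<^bsub>\<Q>\<^esub> (y \<star>\<^bsub>\<Q>\<^esub> z)"
    using car by (simp add: e self_distrib[of a b c] group_simps)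
qed

lemma base_tilde: "(q, \<one>\<^bsub>Adj Q\<^esub>) \<in> carrier \<Q>"
  using base by (simp add: tilde_carrier adj_act_one subgroup.one_closed[OF Adj'_subgroup])

text \<open>A word that leads from \<open>q\<close> to \<open>a\<close> is followed upstairs one letter at a time.\<close>

lemma fibre_nonempty:
  assumes "a \<in> carrier Q"
  shows "\<exists>g. (a, g) \<in> carrier \<Q>"
proof -
  have "\<exists>g. (word_act Q q w, g) \<in> carrier \<Q>" if "w \<in> lists (carrier Q \<times> UNIV)" for w
    using that
  proof (induction w rule: rev_induct)
    case Nil
    then show ?case using base_tilde by auto
  next
    case (snoc l w)
    then obtain g where "(word_act Q q w, g) \<in> carrier \<Q>" by auto
    then show ?case
      using snoc.prems by (cases l) (auto intro: tilde_mult_closed tilde_bar_closed)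
  qed
  then show ?thesis using connected_quandle_word_act[OF connected base assms] by metis
qed

lemma covering_tilde: "quandle_covering \<Q> Q fst"
proof -
  have "fst ` carrier \<Q> = carrier Q"
  proof
    show "fst ` carrier \<Q> \<subseteq> carrier Q" by (auto simp: tilde_carrier)
    show "carrier Q \<subseteq> fst ` carrier \<Q>" using fibre_nonempty by force
  qed
  then show ?thesis
    using quandle_tilde quandle_axioms
    by (auto simp: quandle_covering_def quandle_hom_def)
qed

sublocale covering "tilde_quandle Q q" Q fst
  by (rule covering.intro) (rule covering_tilde)

text \<open>The end point of a lifted path, up to a power of \<open>adj q\<close>. If \<open>(a, g)\<close> is reached along \<open>w\<close>, then
  \<open>adj a = [w]\<inverse> (adj q) [w]\<close> by equivariance, so \<open>[w] (adj a)\<inverse> = (adj q)\<inverse> [w]\<close>: the correction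
  factor that each letter introduces can be moved to the left, where these factors add up to the
  exponent sum.\<close>

lemma tilde_word_act:
  assumes "w \<in> lists (carrier Q \<times> UNIV)"
  shows "adj Q q [^]\<^bsub>Adj Q\<^esub> exponent_sum w
      \<otimes>\<^bsub>Adj Q\<^esub> snd (word_act \<Q> (q, \<one>\<^bsub>Adj Q\<^esub>) (lift_word w))
    = pres_class (carrier Q) (adj_relations Q) w"
  using assms
proof (induction w rule: rev_induct)
  case Nil
  then show ?case by (simp add: one_Adj[symmetric])
next
  case (snoc l w)
  obtain b s where l: "l = (b, s)" by fastforce
  have b: "b \<in> carrier Q" and w: "w \<in> lists (carrier Q \<times> UNIV)" using snoc.prems l by auto
  let ?c = "pres_class (carrier Q) (adj_relations Q)"
  obtain a g where ag: "word_act \<Q> (q, \<one>\<^bsub>Adj Q\<^esub>) (lift_word w) = (a, g)" by fastforce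
  obtain h where h: "inv_into (carrier \<Q>) fst b = (b, h)"
    using inv_into_fibre[OF b] by (metis prod.collapse)
  have "(a, g) \<in> carrier \<Q>" using lift_word_act_closed[OF w base_tilde] ag by simp
  then have car: "a \<in> carrier Q" "g \<in> carrier (Adj Q)" by (auto simp: tilde_carrier Adj'_closed)
  have cw: "?c w \<in> carrier (Adj Q)" using w by (rule class_in_Adj)
  have "a = word_act Q q w" using project_lift_word_act[OF w base_tilde] ag by simp
  then have a: "adj Q a = inv\<^bsub>Adj Q\<^esub> ?c w \<otimes>\<^bsub>Adj Q\<^esub> adj Q q \<otimes>\<^bsub>Adj Q\<^esub> ?c w"
    using adj_word_act[OF w base] by simp
  have IH: "adj Q q [^]\<^bsub>Adj Q\<^esub> exponent_sum w \<otimes>\<^bsub>Adj Q\<^esub> g = ?c w" using snoc w ag by simp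
  \<comment> \<open>Here \<open>e = \<plusminus>1\<close> is the contribution of the last letter, which the powers of \<open>adj q\<close> allow to split
    off on the left, and \<open>k\<close> is the factor by which that letter changes \<open>g\<close>.\<close>
  have pow: "adj Q q [^]\<^bsub>Adj Q\<^esub> (e + exponent_sum w) \<otimes>\<^bsub>Adj Q\<^esub> (g \<otimes>\<^bsub>Adj Q\<^esub> k)
      = adj Q q [^]\<^bsub>Adj Q\<^esub> e \<otimes>\<^bsub>Adj Q\<^esub> (?c w \<otimes>\<^bsub>Adj Q\<^esub> k)"
    if "k \<in> carrier (Adj Q)" for k and e :: int
    using that base car by (simp add: IH[symmetric] Adj.int_pow_mult Adj.m_assoc)
  have m1: "adj Q q [^]\<^bsub>Adj Q\<^esub> (-1 :: int) = inv\<^bsub>Adj Q\<^esub> adj Q q"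
    using base Adj.int_pow_neg[of "adj Q q" 1] by simp
  have step: "?c (w @ [(b, t)]) = ?c w \<otimes>\<^bsub>Adj Q\<^esub> (if t then adj Q b else inv\<^bsub>Adj Q\<^esub> adj Q b)" for t
    using class_append[of w Q "[(b, t)]"] class_letter[OF b] w b by simp
  show ?case
  proof (cases s)
    case True
    then show ?thesis
      using pow[of "inv\<^bsub>Adj Q\<^esub> adj Q a \<otimes>\<^bsub>Adj Q\<^esub> adj Q b" 1] car base b cw
      by (simp add: step l ag h Adj.m_assoc add.commute)
        (simp add: a Adj.m_assoc Adj.inv_mult_group Adj.inv_mult_cancel)
  next
    case False
    then show ?thesis
      using pow[of "adj Q a \<otimes>\<^bsub>Adj Q\<^esub> inv\<^bsub>Adj Q\<^esub> adj Q b" "-1"] car base b cw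
      by (simp add: step l ag h Adj.m_assoc add.commute m1)
        (simp add: a Adj.m_assoc Adj.inv_mult_group Adj.inv_mult_cancel)
  qed
qed

text \<open>An element \<open>g\<close> of the derived subgroup has degree 0, so along any word representing it the
  power of \<open>adj q\<close> in \<open>tilde_word_act\<close> is trivial, and the lifted path ends at \<open>g\<close> itself.\<close>

lemma connected_tilde: "connected_quandle \<Q>"
proof (rule P.connectedI[OF base_tilde])
  fix y assume y: "y \<in> carrier \<Q>"
  obtain a g where ag: "y = (a, g)" by fastforce
  have g: "g \<in> Adj'" "a = adj_act Q q g" using y ag by (auto simp: tilde_carrier)
  obtain w where w: "w \<in> lists (carrier Q \<times> UNIV)"
    "g = pres_class (carrier Q) (adj_relations Q) w"
    using g Adj'_closed Adj_cases by metis
  let ?z = "word_act \<Q> (q, \<one>\<^bsub>Adj Q\<^esub>) (lift_word w)"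
  have "?z \<in> carrier \<Q>" using lift_word_act_closed[OF w(1) base_tilde] .
  then have "snd ?z \<in> carrier (Adj Q)" by (cases ?z) (auto simp: tilde_carrier Adj'_closed)
  moreover have "exponent_sum w = 0" using Adj_degree_derived[OF g(1)] w Adj_degree_class by metis
  ultimately have "snd ?z = g" using tilde_word_act[OF w(1)] w(2) by simp
  moreover have "fst ?z = a"
    using project_lift_word_act[OF w(1) base_tilde] g w base by (simp add: adj_act_class)
  ultimately have "?z = y" using ag by (simp add: prod_eq_iff)
  then show "\<exists>w \<in> lists (carrier \<Q> \<times> UNIV). word_act \<Q> (q, \<one>\<^bsub>Adj Q\<^esub>) w = y"
    using lift_word_closed[OF w(1)] by blast
qed

text \<open>The witness is \<open>(a, g) \<mapsto> x'\<^sup>g\<close> for the action of \<open>Adj Q\<close> on the competing covering. It is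
  multiplicative since in \<open>g (adj a)\<inverse> (adj b)\<close> the second factor fixes \<open>x'\<^sup>g\<close>, which lies over
  \<open>a\<close>, and the third is translation by \<open>x'\<^sup>h\<close>, which lies over \<open>b\<close>.\<close>

lemma lift_exists:
  assumes "pointed_quandle_covering P' x' Q q p'"
  shows "\<exists>\<phi> \<in> quandle_hom \<Q> P' \<inter> extensional (carrier \<Q>).
    \<phi> (q, \<one>\<^bsub>Adj Q\<^esub>) = x' \<and> (\<forall>y \<in> carrier \<Q>. p' (\<phi> y) = fst y)"
proof -
  interpret C: covering P' Q p'
    using assms by (simp add: covering_def pointed_quandle_covering_def)
  have x': "x' \<in> carrier P'" "p' x' = q"
    using assms by (auto simp: pointed_quandle_covering_def)
  define \<phi> where "\<phi> = (\<lambda>y \<in> carrier \<Q>. C.lift_act x' (snd y))"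
  have \<phi>: "\<phi> (a, g) = C.lift_act x' g" "C.lift_act x' g \<in> carrier P'" "p' (C.lift_act x' g) = a"
    "a \<in> carrier Q" "g \<in> carrier (Adj Q)"
    if "(a, g) \<in> carrier \<Q>" for a g
    using that x' by (auto simp: \<phi>_def tilde_carrier Adj'_closed C.lift_act_closed C.project_lift_act)
  have "\<phi> ((a, g) \<star>\<^bsub>\<Q>\<^esub> (b, h)) = \<phi> (a, g) \<star>\<^bsub>P'\<^esub> \<phi> (b, h)"
    if ag: "(a, g) \<in> carrier \<Q>" and bh: "(b, h) \<in> carrier \<Q>" for a g b h
  proof -
    have "\<phi> ((a, g) \<star>\<^bsub>\<Q>\<^esub> (b, h))
        = C.lift_act x' (g \<otimes>\<^bsub>Adj Q\<^esub> inv\<^bsub>Adj Q\<^esub> adj Q a \<otimes>\<^bsub>Adj Q\<^esub> adj Q b)"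
      using \<phi>(1) P.mult_closed[OF ag bh] by simp
    also have "\<dots> = C.lift_act (C.lift_act (C.lift_act x' g) (inv\<^bsub>Adj Q\<^esub> adj Q a)) (adj Q b)"
      using \<phi>[OF ag] \<phi>[OF bh] x' by (simp add: C.lift_act_mult)
    also have "C.lift_act (C.lift_act x' g) (inv\<^bsub>Adj Q\<^esub> adj Q a) = C.lift_act x' g"
      using C.lift_act_inv_adj_self[OF \<phi>(2)[OF ag]] \<phi>(3)[OF ag] by simp
    also have "C.lift_act (C.lift_act x' g) (adj Q b) = C.lift_act x' g \<star>\<^bsub>P'\<^esub> C.lift_act x' h"
      using C.lift_act_adj[OF \<phi>(2)[OF ag] \<phi>(2)[OF bh]] \<phi>(3)[OF bh] by simp
    finally show ?thesis using \<phi>(1) ag bh by simp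
  qed
  then have "\<phi> \<in> quandle_hom \<Q> P' \<inter> extensional (carrier \<Q>)"
    using \<phi>(1,2) unfolding quandle_hom_def by (auto simp del: tilde_ops) (simp add: \<phi>_def)
  moreover have "\<phi> (q, \<one>\<^bsub>Adj Q\<^esub>) = x'" using \<phi>(1)[OF base_tilde] x' by (simp add: C.lift_act_one)
  moreover have "\<forall>y \<in> carrier \<Q>. p' (\<phi> y) = fst y" using \<phi>(1,3) by auto
  ultimately show ?thesis by blast
qed

lemma universal_tilde:
  "universal_quandle_covering TYPE('c) \<Q> (q, \<one>\<^bsub>Adj Q\<^esub>) Q q fst"
  unfolding universal_quandle_covering_def
proof (intro conjI allI impI)
  show "pointed_quandle_covering \<Q> (q, \<one>\<^bsub>Adj Q\<^esub>) Q q fst"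
    using covering_tilde base_tilde base by (simp add: pointed_quandle_covering_def)
  fix P' :: "'c quandle" and x' p'
  assume *: "pointed_quandle_covering P' x' Q q p'"
  interpret C: covering P' Q p'
    using * by (simp add: covering_def pointed_quandle_covering_def)
  have "\<phi> = \<psi>"
    if "\<phi> \<in> quandle_hom \<Q> P' \<inter> extensional (carrier \<Q>)" "\<psi> \<in> quandle_hom \<Q> P' \<inter> extensional (carrier \<Q>)"
      "\<phi> (q, \<one>\<^bsub>Adj Q\<^esub>) = \<psi> (q, \<one>\<^bsub>Adj Q\<^esub>)" "\<forall>y \<in> carrier \<Q>. p' (\<phi> y) = p' (\<psi> y)" for \<phi> \<psi>
    using that C.lift_unique[OF connected_tilde base_tilde, of \<phi> \<psi>]
    by (intro extensionalityI[of \<phi> "carrier \<Q>" \<psi>]) auto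
  then show "\<exists>!\<phi>. \<phi> \<in> quandle_hom \<Q> P' \<inter> extensional (carrier \<Q>) \<and>
      \<phi> (q, \<one>\<^bsub>Adj Q\<^esub>) = x' \<and> (\<forall>y \<in> carrier \<Q>. p' (\<phi> y) = fst y)"
    using lift_exists[OF *] by (intro ex_ex1I) (blast, auto)
qed

end

theorem theorem5p3:
  fixes Q :: "('a, 'm) quandle_scheme" and q :: 'a
  assumes "connected_quandle Q" and "q \<in> carrier Q"
  shows "connected_quandle (tilde_quandle Q q) \<and>
    universal_quandle_covering TYPE('c) (tilde_quandle Q q) (q, \<one>\<^bsub>Adj Q\<^esub>) Q q fst"
proof -
  interpret pointed_connected_quandle Q q
    using assms
    by (simp add: pointed_connected_quandle_def pointed_connected_quandle_axioms_def
        connected_quandle_def)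
  show ?thesis using connected_tilde universal_tilde by blast
qed

end
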